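(* Let $A$ and $\widetilde{A}$ be compact linear operators from $X$ to $Y$, let $A_\Theta=F_\Theta\circ\widetilde{A}$, and given the solutions $$\hat{x}\in\operatorname{arg\,min}_{x}\ \tfrac12\|Ax-y\|_Y^2,\qquad (1)$$ $$\hat{x}_\Theta\ \text{ critical point of }\ \tfrac12\|A_\Theta(x)-y\|_Y^2.\qquad (2)$$ If $\widetilde{x}_0\in\operatorname{rng}(\widetilde{A}^* )$ and $\hat{x}\notin\overline{\operatorname{rng}(\widetilde{A}^* )}$, then a gradient-descent algorithm for the functional in (2), initialised with $\widetilde{x}_0$, yields a solution such that $\hat{x}_\Theta\neq\hat{x}$ for any $\hat{x}$ solving (1).
   Context: $X$ and $Y$ are Hilbert spaces with norms $\|\cdot\|_X,\|\cdot\|_Y$, and $y\in Y$ is the given measurement. $A$ is the accurate forward operator and $\widetilde{A}$ the approximate forward operator. $F_\Theta:Y\to Y$ is a parameterisable, possibly nonlinear, Fréchet differentiable correction with parameters $\Theta$, and $DF_\Theta(z):Y\to Y$ denotes its Fréchet derivative at $z\in Y$, a linear operator. $A_\Theta=F_\Theta\circ\widetilde{A}:X\to Y$ is the corrected operator. $\widetilde{A}^*:Y\to X$ is the adjoint of $\widetilde{A}$, $\operatorname{rng}$ denotes the range of an operator, and the overline denotes closure. The gradient of the functional in (2) is $$\nabla_x\tfrac12\|A_\Theta(x)-y\|_Y^2=\widetilde{A}^*\,[DF_\Theta(\widetilde{A}x)]^*\,\big(F_\Theta(\widetilde{A}x)-y\big),$$ and gradient descent has the updates $\widetilde{x}_{k+1}=\widetilde{x}_k-\lambda_k\nabla_{\widetilde{x}_k}\tfrac12\|A_\Theta(\widetilde{x}_k)-y\|_Y^2$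 with step sizes $\lambda_k>0$. *)

theory Defs
  imports "HOL-Analysis.Analysis"
begin

text \<open>
  Hilbert spaces are real and are rendered by the sort
  \<open>{real_inner, complete_space}\<close>.
\<close>

definition compact_operator ::
    "('a::real_normed_vector \<Rightarrow> 'b::real_normed_vector) \<Rightarrow> bool" where
  "compact_operator T \<longleftrightarrow>
     linear T \<and> (\<forall>S. bounded S \<longrightarrow> compact (closure (T ` S)))"

definition data_fit :: "('a \<Rightarrow> 'b::real_normed_vector) \<Rightarrow> 'b \<Rightarrow> 'a \<Rightarrow> real" where
  "data_fit T y x = 1 / 2 * (norm (T x - y))\<^sup>2"

definition critical_point :: "('a::real_inner \<Rightarrow> real) \<Rightarrow> 'a \<Rightarrow> bool" where
  "critical_point J x \<longleftrightarrow> (GDERIV J x :> 0)"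

text \<open>
  The gradient \<open>g\<close> is the library's \<open>GDERIV\<close>, i.e. the Riesz representative of the
  Frechet derivative of \<open>J\<close>; it is unique where it exists.  For
  \<open>J = data_fit (F \<circ> T) y\<close> with \<open>T\<close> bounded linear and \<open>F\<close> differentiable it exists
  everywhere and equals \<open>T\<^sup>* (DF (T x))\<^sup>* (F (T x) - y)\<close>.
\<close>

definition gradient_descent ::
    "('a::real_inner \<Rightarrow> real) \<Rightarrow> (nat \<Rightarrow> real) \<Rightarrow> (nat \<Rightarrow> 'a) \<Rightarrow> bool" where
  "gradient_descent J stp xs \<longleftrightarrow>
     (\<forall>k. stp k > 0 \<and>
       (\<exists>g. (GDERIV J (xs k) :> g) \<and> xs (Suc k) = xs k - stp k *\<^sub>R g))"

end

theory Submission
  imports Defs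
begin

text \<open>
  Gradient descent never leaves the range of the adjoint.  By the chain rule, the gradient at
  \<open>x\<close> of any functional of the form \<open>L \<circ> T\<close>, with \<open>T\<close> bounded linear and \<open>L\<close>
  differentiable, is \<open>T\<^sup>* w\<close>, where \<open>w\<close> represents the derivative of \<open>L\<close> at \<open>T x\<close>.  The
  corrected data fit has this form with \<open>L z = 1/2 \<parallel>F z - y\<parallel>\<^sup>2\<close>: however nonlinear the
  correction \<open>F\<close> is, it acts after \<open>T\<close> and so only changes \<open>w\<close>.  Since the range of
  \<open>T\<^sup>*\<close> is a subspace, an iteration that starts there stays there, and its limit lies in
  the closure of that range, to which the minimiser of the accurate problem does not belong.

  What needs work is that \<open>adjoint T\<close>, a Hilbert choice, really satisfies the adjoint identity
  in infinite dimension, and that \<open>w\<close> exists.  Both follow from the Riesz representation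
  theorem, which is where completeness enters; compactness of the approximate operator is used
  through the boundedness that it implies.
\<close>

text \<open>
  The representing vector is the minimiser of \<open>\<phi> x = x \<bullet> x - 2 * f x\<close>, at which the derivative
  \<open>h \<mapsto> 2 (h \<bullet> u) - 2 f h\<close> vanishes.  The minimum is attained because the parallelogram law
  makes every minimising sequence Cauchy.
\<close>
lemma riesz_representation:
  fixes f :: "'a::{real_inner, complete_space} \<Rightarrow> real"
  assumes "bounded_linear f"
  shows "\<exists>u. \<forall>h. f h = h \<bullet> u"
proof -
  interpret f: bounded_linear f by fact
  define \<phi> where "\<phi> x = x \<bullet> x - 2 * f x" for x
  define m where "m = Inf (range \<phi>)"
  obtain K where K: "norm (f x) \<le> norm x * K" for x
    using f.bounded by blast
  have "- K\<^sup>2 \<le> \<phi> x" for x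
  proof -
    have "0 \<le> (norm x - K)\<^sup>2" by simp
    also have "\<dots> \<le> \<phi> x + K\<^sup>2"
      using K[of x] unfolding \<phi>_def power2_norm_eq_inner[symmetric]
      by (simp add: power2_diff abs_le_iff algebra_simps)
    finally show ?thesis by simp
  qed
  then have bdd: "bdd_below (range \<phi>)"
    by (auto intro: bdd_belowI[where m = "- K\<^sup>2"])
  have lower: "m \<le> \<phi> x" for x
    unfolding m_def using bdd by (simp add: cINF_lower)
  \<comment> \<open>The linear part of \<open>\<phi>\<close> cancels, which leaves the parallelogram law.\<close>
  have midpoint: "\<phi> a + \<phi> b = 2 * \<phi> ((1/2) *\<^sub>R (a + b)) + (dist a b)\<^sup>2 / 2" for a b
    unfolding \<phi>_def dist_norm power2_norm_eq_inner
    by (simp add: f.scaleR f.add inner_commute[of b a] inner_add_left inner_add_right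
        inner_diff_left inner_diff_right field_simps)
  have "\<exists>x. \<phi> x < m + 1 / real (Suc n)" for n
  proof -
    have "Inf (range \<phi>) < m + 1 / real (Suc n)" by (simp add: m_def)
    then show ?thesis using cInf_lessD[of "range \<phi>"] by blast
  qed
  then obtain X where X: "\<phi> (X n) < m + 1 / real (Suc n)" for n
    by metis
  \<comment> \<open>The midpoint also has value at least \<open>m\<close>, so two almost minimal points must be close.\<close>
  have gap: "(dist (X i) (X j))\<^sup>2 \<le> 4 / real (Suc N)" if "i \<ge> N" "j \<ge> N" for i j N
  proof -
    have "1 / real (Suc i) \<le> 1 / real (Suc N)" "1 / real (Suc j) \<le> 1 / real (Suc N)"
      using that by (simp_all add: frac_le)
    with X[of i] X[of j] midpoint[of "X i" "X j"] lower[of "(1/2) *\<^sub>R (X i + X j)"]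
    show ?thesis by linarith
  qed
  have "Cauchy X"
  proof (rule metric_CauchyI)
    fix e :: real assume "0 < e"
    then have "0 < e\<^sup>2 / 4" by simp
    then obtain N where "1 / real (Suc N) < e\<^sup>2 / 4"
      using nat_approx_posE by blast
    then have N: "4 / real (Suc N) < e\<^sup>2" by simp
    have "dist (X i) (X j) < e" if "i \<ge> N" "j \<ge> N" for i j
      using power2_less_imp_less[OF order_le_less_trans[OF gap[OF that] N]] \<open>0 < e\<close>
      by simp
    then show "\<exists>N. \<forall>i\<ge>N. \<forall>j\<ge>N. dist (X i) (X j) < e" by blast
  qed
  then obtain u where u: "X \<longlonglongrightarrow> u"
    using Cauchy_convergent convergent_def by blast
  have "(\<lambda>n. \<phi> (X n)) \<longlonglongrightarrow> \<phi> u"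
    unfolding \<phi>_def by (intro tendsto_intros f.tendsto u)
  moreover have "(\<lambda>n. m + 1 / real (Suc n)) \<longlonglongrightarrow> m"
    using tendsto_add[OF tendsto_const lim_1_over_n, THEN LIMSEQ_Suc, of m] by simp
  ultimately have "\<phi> u \<le> m"
    using X by (intro LIMSEQ_le) (auto intro: less_imp_le)
  then have min: "\<phi> u \<le> \<phi> x" for x
    using lower[of x] by simp
  have "(\<phi> has_derivative (\<lambda>h. u \<bullet> h + h \<bullet> u - 2 * f h)) (at u)"
    unfolding \<phi>_def by (intro derivative_intros f.has_derivative)
  then have "(\<lambda>h. u \<bullet> h + h \<bullet> u - 2 * f h) = (\<lambda>h. 0)"
    by (rule has_derivative_local_min) (simp add: min)
  then show ?thesis
    by (intro exI[of _ u]) (auto simp: fun_eq_iff inner_commute)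
qed

lemma compact_operator_bounded_linear:
  assumes "compact_operator T"
  shows "bounded_linear T"
proof -
  have lin: "linear T" and "compact (closure (T ` cball 0 1))"
    using assms unfolding compact_operator_def by auto
  then have "bounded (T ` cball 0 1)"
    by (meson bounded_subset closure_subset compact_imp_bounded)
  then obtain K where K: "norm (T x) \<le> K" if "norm x \<le> 1" for x
    unfolding bounded_iff by fastforce
  have "norm (T x) \<le> norm x * K" for x
  proof (cases "x = 0")
    case False
    then show ?thesis
      using K[of "x /\<^sub>R norm x"]
      by (simp add: linear_scale[OF lin] field_simps)
  qed (simp add: linear_0[OF lin])
  with lin show ?thesis
    by (intro bounded_linear.intro bounded_linear_axioms.intro) auto
qed

text \<open>
  The choice in \<open>adjoint\<close> is meaningful as soon as some adjoint exists: at \<open>w\<close> it is the Riesz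
  representative of \<open>x \<mapsto> T x \<bullet> w\<close>.
\<close>
lemma adjoint_bounded_linear:
  fixes T :: "'a::{real_inner, complete_space} \<Rightarrow> 'b::real_inner"
  assumes "bounded_linear T"
  shows "T x \<bullet> w = x \<bullet> adjoint T w"
proof -
  have "\<exists>u. \<forall>x. T x \<bullet> w = x \<bullet> u" for w
    using riesz_representation[OF bounded_linear_compose[OF bounded_linear_inner_left assms]] .
  then have "\<exists>f'. \<forall>x w. T x \<bullet> w = x \<bullet> f' w" by metis
  then show ?thesis
    unfolding adjoint_def by (rule someI2_ex) simp
qed

lemma subspace_range_adjoint:
  fixes T :: "'a::{real_inner, complete_space} \<Rightarrow> 'b::real_inner"
  assumes "bounded_linear T"
  shows "subspace (range (adjoint T))"
proof -
  note adj = adjoint_bounded_linear[OF assms]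
  have "linear (adjoint T)"
  proof (rule linearI)
    fix v w
    have "\<forall>x. x \<bullet> adjoint T (v + w) = x \<bullet> (adjoint T v + adjoint T w)"
      by (simp add: inner_add_right flip: adj)
    then show "adjoint T (v + w) = adjoint T v + adjoint T w"
      by (simp only: vector_eq_ldot)
  next
    fix c v
    have "\<forall>x. x \<bullet> adjoint T (c *\<^sub>R v) = x \<bullet> (c *\<^sub>R adjoint T v)"
      by (simp flip: adj)
    then show "adjoint T (c *\<^sub>R v) = c *\<^sub>R adjoint T v"
      by (simp only: vector_eq_ldot)
  qed
  then show ?thesis by (rule linear_subspace_image) simp
qed

text \<open>
  If \<open>w\<close> represents the derivative of \<open>L\<close> at \<open>T x\<close>, then the derivative of the composition at
  \<open>x\<close> is \<open>h \<mapsto> T h \<bullet> w = h \<bullet> adjoint T w\<close>, and gradients are unique.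
\<close>
lemma gderiv_compose_in_range_adjoint:
  fixes T :: "'a::{real_inner, complete_space} \<Rightarrow> 'b::{real_inner, complete_space}"
  assumes T: "bounded_linear T"
    and L: "L differentiable at (T x)"
    and g: "GDERIV (\<lambda>x. L (T x)) x :> g"
  shows "g \<in> range (adjoint T)"
proof -
  obtain L' where L': "(L has_derivative L') (at (T x))"
    using L by (auto simp: differentiable_def)
  obtain w where w: "L' k = k \<bullet> w" for k
    using riesz_representation[OF has_derivative_bounded_linear[OF L']] by blast
  have "((\<lambda>x. L (T x)) has_derivative (\<lambda>h. L' (T h))) (at x)"
    using has_derivative_compose[OF bounded_linear_imp_has_derivative[OF T] L'] .
  with g have "(\<lambda>h. h \<bullet> g) = (\<lambda>h. L' (T h))"
    unfolding gderiv_def by (rule has_derivative_unique)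
  then have "\<forall>h. h \<bullet> g = h \<bullet> adjoint T w"
    by (simp add: fun_eq_iff w adjoint_bounded_linear[OF T])
  then have "g = adjoint T w"
    by (simp only: vector_eq_ldot)
  then show ?thesis by simp
qed

theorem theorem3p1:
  fixes A At :: "'x::{real_inner, complete_space} \<Rightarrow> 'y::{real_inner, complete_space}"
    and F :: "'p \<Rightarrow> 'y \<Rightarrow> 'y" and \<Theta> :: 'p
    and y :: 'y
    and xs :: "nat \<Rightarrow> 'x" and stp :: "nat \<Rightarrow> real"
    and xhat xhat\<Theta> :: 'x
  assumes "compact_operator A" and "compact_operator At"
    and "\<forall>z. F \<Theta> differentiable (at z)"
    and "is_arg_min (data_fit A y) (\<lambda>_. True) xhat"
    and "critical_point (data_fit (F \<Theta> \<circ> At) y) xhat\<Theta>"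
    and "xs 0 \<in> range (adjoint At)"
    and "xhat \<notin> closure (range (adjoint At))"
    and "gradient_descent (data_fit (F \<Theta> \<circ> At) y) stp xs"
    and "xs \<longlonglongrightarrow> xhat\<Theta>"
  shows "xhat\<Theta> \<noteq> xhat"
proof -
  have At: "bounded_linear At"
    using assms(2) by (rule compact_operator_bounded_linear)
  let ?V = "range (adjoint At)"
  have V: "subspace ?V"
    using At by (rule subspace_range_adjoint)
  define L where "L z = 1 / 2 * (norm (F \<Theta> z - y))\<^sup>2" for z
  have J: "data_fit (F \<Theta> \<circ> At) y = (\<lambda>x. L (At x))"
    by (simp add: fun_eq_iff data_fit_def L_def)
  have L: "L differentiable at z" for z
    unfolding L_def power2_norm_eq_inner
    using assms(3) by (intro derivative_intros) auto
  have iterates: "xs k \<in> ?V" for k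
  proof (induction k)
    case 0
    show ?case by fact
  next
    case (Suc k)
    obtain g where g: "GDERIV (\<lambda>x. L (At x)) (xs k) :> g"
      and step: "xs (Suc k) = xs k - stp k *\<^sub>R g"
      using assms(8) unfolding gradient_descent_def J by blast
    have "g \<in> ?V"
      using At L g by (rule gderiv_compose_in_range_adjoint)
    then show ?case
      unfolding step using Suc V by (intro subspace_diff subspace_scale)
  qed
  then have "xhat\<Theta> \<in> closure ?V"
    using assms(9) by (auto simp: closure_sequential)
  then show ?thesis
    using assms(7) by blast
qed

end
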